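(* Let $G$ be a finite simple connected graph. Then $G$ satisfies property (P2) if and only if $G$ is an extended block graph.
   Context: For a connected graph $G$, $d(u,v)$ denotes the shortest-path distance in $G$, $N(x)$ the set of neighbours of $x$, and $N[x]=N(x)\cup\{x\}$. For $c,x\in V(G)$ with $d(c,x)\ge 2$, let $N(c,x)=\{v\in N(c): d(c,x)=1+d(v,x)\}$ (the neighbours of $c$ lying on a shortest $c$–$x$ path). Property (P2): for any $c,x,y\in V(G)$ and any $c'\in N(c,x)$ with $d(c,x)\ge 2$ and $d(c',y)\ge 2$, either $d(c,y)=d(c,c')+d(c',y)$ or $d(x,y)=d(x,c')+d(c',y)$. A block graph is a connected graph in which every block (maximal 2-connected subgraph) is complete. An extended block graph is a connected graph obtained from a block graph by "blowing up" cut vertices: each cut vertex is replaced by a clique (a joint block), and every vertex of that clique is joined to every neighbour of the replaced cut vertex. *)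

theory Defs
  imports "Graph_Theory.Graph_Theory"
begin

text \<open>
  A finite simple graph is a digraph in the locale \<^locale>\<open>graph\<close> of the entry Graph_Theory:
  finite, loop-free, without multiple arcs and symmetric, an edge being a pair of opposite arcs.
  Note that \<^const>\<open>connected\<close> includes having at least one vertex.
\<close>

definition gdist :: "('a, 'b) pre_digraph \<Rightarrow> 'a \<Rightarrow> 'a \<Rightarrow> ereal" where
  "gdist G u v = wf_digraph.\<mu> G (\<lambda>_. 1) u v"

definition nbrs :: "('a, 'b) pre_digraph \<Rightarrow> 'a \<Rightarrow> 'a set" where
  "nbrs G x = {v. x \<rightarrow>\<^bsub>G\<^esub> v}"

definition nbrs_towards :: "('a, 'b) pre_digraph \<Rightarrow> 'a \<Rightarrow> 'a \<Rightarrow> 'a set" where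
  "nbrs_towards G c x = {v \<in> nbrs G c. gdist G c x = 1 + gdist G v x}"

definition property_P2 :: "('a, 'b) pre_digraph \<Rightarrow> bool" where
  "property_P2 G \<longleftrightarrow>
    (\<forall>c \<in> verts G. \<forall>x \<in> verts G. \<forall>y \<in> verts G. \<forall>c' \<in> nbrs_towards G c x.
      gdist G c x \<ge> 2 \<and> gdist G c' y \<ge> 2 \<longrightarrow>
        gdist G c y = gdist G c c' + gdist G c' y \<or>
        gdist G x y = gdist G x c' + gdist G c' y)"

text \<open>A cut vertex separates two other vertices of its connected component.\<close>

definition cut_vertex :: "('a, 'b) pre_digraph \<Rightarrow> 'a \<Rightarrow> bool" where
  "cut_vertex G v \<longleftrightarrow> v \<in> verts G \<and>
    (\<exists>u \<in> verts G - {v}. \<exists>w \<in> verts G - {v}.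
       u \<rightarrow>\<^sup>*\<^bsub>G\<^esub> w \<and> \<not> u \<rightarrow>\<^sup>*\<^bsub>pre_digraph.del_vert G v\<^esub> w)"

text \<open>
  As usual in the context of blocks, 2-connected means connected without a cut vertex, so that
  bridges (and an isolated vertex) form blocks as well. Requiring at least three vertices instead
  would not change the notion of a block graph: a connected graph with at most two vertices is
  complete.
\<close>

definition two_connected :: "('a, 'b) pre_digraph \<Rightarrow> bool" where
  "two_connected G \<longleftrightarrow> graph G \<and> connected G \<and> (\<forall>v. \<not> cut_vertex G v)"

definition block_of :: "('a, 'b) pre_digraph \<Rightarrow> ('a, 'b) pre_digraph \<Rightarrow> bool" where
  "block_of G B \<longleftrightarrow> pre_digraph.max_subgraph G two_connected B"

definition block_graph :: "('a, 'b) pre_digraph \<Rightarrow> bool" where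
  "block_graph G \<longleftrightarrow> graph G \<and> connected G \<and>
    (\<forall>B. block_of G B \<longrightarrow> complete_digraph (card (verts B)) B)"

text \<open>
  \<open>f\<close> sends each vertex of \<open>G\<close> to the vertex of \<open>H\<close> it comes from: the fibre over a cut vertex
  \<open>v\<close> of \<open>H\<close> is the nonempty clique that replaces \<open>v\<close> (a single vertex if \<open>v\<close> is left as it is);
  all other vertices of \<open>H\<close> are kept.
\<close>

definition blow_up_via :: "('c, 'd) pre_digraph \<Rightarrow> ('a, 'b) pre_digraph \<Rightarrow> ('a \<Rightarrow> 'c) \<Rightarrow> bool" where
  "blow_up_via H G f \<longleftrightarrow>
    f ` verts G = verts H \<and>
    (\<forall>v \<in> verts H. \<not> cut_vertex H v \<longrightarrow> (\<exists>!u. u \<in> verts G \<and> f u = v)) \<and>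
    (\<forall>u \<in> verts G. \<forall>w \<in> verts G.
       u \<rightarrow>\<^bsub>G\<^esub> w \<longleftrightarrow> u \<noteq> w \<and> (f u = f w \<or> f u \<rightarrow>\<^bsub>H\<^esub> f w))"

text \<open>
  Choosing one vertex from each fibre identifies \<open>H\<close> with a graph on a subset of the vertices of
  \<open>G\<close>, and an arc of a simple graph is determined by its ends. Hence it is no restriction that
  \<open>H\<close> has vertices in the type of those of \<open>G\<close> and pairs of vertices as arcs.
\<close>

definition extended_block_graph :: "('a, 'b) pre_digraph \<Rightarrow> bool" where
  "extended_block_graph G \<longleftrightarrow> graph G \<and> connected G \<and>
    (\<exists>(H :: ('a, 'a \<times> 'a) pre_digraph) f. block_graph H \<and> blow_up_via H G f)"

end

theory Submission
  imports Defs
begin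

text \<open>
  A connected graph is a block graph iff the middle vertex of every induced path \<open>u, v, w\<close>
  separates \<open>u\<close> from \<open>w\<close>. If (P2) holds and \<open>c, v, x\<close> is an induced path in \<open>G\<close>, then the set
  of all \<open>y\<close> with \<open>d(c, y) \<le> d(v, y)\<close> is closed under adjacency outside the class of true twins of
  \<open>v\<close>, and it contains \<open>c\<close> but not \<open>x\<close>. So this class separates \<open>c\<close> from \<open>x\<close>, and collapsing the
  twin classes of all vertices whose neighbourhood is not a clique yields a block graph. Conversely,
  in a blow-up of a block graph the fibre containing \<open>c'\<close> separates \<open>c\<close> from \<open>x\<close>, hence \<open>y\<close> from
  one of them, and a geodesic passing through the fibre gives (P2).
\<close>

section \<open>Separation and induced subgraphs\<close>

lemma dominates_induce_subgraph_iff: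
  "u \<rightarrow>\<^bsub>G \<restriction> S\<^esub> v \<longleftrightarrow> u \<in> S \<and> v \<in> S \<and> u \<rightarrow>\<^bsub>G\<^esub> v"
  by (auto simp: arcs_ends_conv)

lemma (in wf_digraph) del_vert_eq_induce: "del_vert v = G \<restriction> (verts G - {v})"
  by (auto simp: del_vert_def induce_subgraph_def)

lemma reachable_mono_ends:
  assumes "u \<rightarrow>\<^sup>*\<^bsub>G\<^esub> v" "verts G \<subseteq> verts H" "arcs_ends G \<subseteq> arcs_ends H"
  shows "u \<rightarrow>\<^sup>*\<^bsub>H\<^esub> v"
  using assms unfolding reachable_def by (blast intro: rtrancl_on_mono)

text \<open>Separation claims below are proved by contradiction from the single arc on which a walk
  leaves a suitable set.\<close>

lemma (in wf_digraph) reachable_exit: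
  assumes "u \<rightarrow>\<^sup>* v" "u \<in> S" "v \<notin> S"
  obtains a b where "a \<in> S" "b \<notin> S" "a \<rightarrow>\<^bsub>G\<^esub> b"
proof -
  have "\<exists>a b. a \<in> S \<and> b \<notin> S \<and> a \<rightarrow>\<^bsub>G\<^esub> b"
    using assms by (induct rule: reachable_induct) auto
  then show ?thesis using that by blast
qed

context graph
begin

lemma adj_sym: "u \<rightarrow>\<^bsub>G\<^esub> v \<Longrightarrow> v \<rightarrow>\<^bsub>G\<^esub> u"
  by (rule graph_symmetric)

lemma adj_irrefl: "\<not> u \<rightarrow>\<^bsub>G\<^esub> u"
  using adj_not_same by blast

lemma graph_induce:
  assumes "S \<subseteq> verts G"
  shows "graph (G \<restriction> S)"
proof -
  have "induced_subgraph (G \<restriction> S) G" using assms by (rule induced_induce)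
  then interpret D: digraph "G \<restriction> S" by (rule digraphI_induced)
  have "symmetric (G \<restriction> S)"
    by (rule induced_graph_imp_symmetric[OF sym_arcs]) fact
  then show ?thesis by (rule D.graphI)
qed

text \<open>\<open>connected\<close> speaks of the symmetric closure. The arcs here are symmetric
  already, so taking the closure does not change reachability.\<close>

lemma connected_iff_reachable:
  "connected G \<longleftrightarrow> verts G \<noteq> {} \<and> (\<forall>u \<in> verts G. \<forall>v \<in> verts G. u \<rightarrow>\<^sup>* v)"
  using reachable_mk_symmetric_eq[OF sym_arcs]
  unfolding connected_def strongly_connected_def by simp

lemma two_connected_iff:
  "two_connected G \<longleftrightarrow> connected G \<and>
    (\<forall>v \<in> verts G. \<forall>a \<in> verts G - {v}. \<forall>b \<in> verts G - {v}. a \<rightarrow>\<^sup>*\<^bsub>G \<restriction> (verts G - {v})\<^esub> b)"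
proof -
  have "graph G" by unfold_locales
  then show ?thesis
    unfolding two_connected_def cut_vertex_def del_vert_eq_induce
    using connected_iff_reachable by blast
qed

lemma reachable_along_vwalk:
  assumes "vwalk q G" "set q \<subseteq> T" "T \<subseteq> verts G" "a \<in> set q" "b \<in> set q"
  shows "a \<rightarrow>\<^sup>*\<^bsub>G \<restriction> T\<^esub> b"
proof -
  interpret T: graph "G \<restriction> T" using assms(3) by (rule graph_induce)
  have *: "\<forall>a \<in> set q. hd q \<rightarrow>\<^sup>*\<^bsub>G \<restriction> T\<^esub> a"
    using assms(1,2)
  proof (induct rule: vwalk_induct)
    case (Base u)
    then show ?case by simp
  next
    case (Cons u v es)
    then have "u \<rightarrow>\<^bsub>G \<restriction> T\<^esub> v" by (simp add: dominates_induce_subgraph_iff)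
    with Cons show ?case by (auto intro: T.adj_reachable_trans)
  qed
  have "a \<rightarrow>\<^sup>*\<^bsub>G \<restriction> T\<^esub> hd q"
    using * assms(4) by (blast intro: T.symmetric_reachable')
  also have "hd q \<rightarrow>\<^sup>*\<^bsub>G \<restriction> T\<^esub> b" using * assms(5) by blast
  finally show ?thesis .
qed

end

section \<open>Block graphs\<close>

text \<open>Among the 2-connected subgraphs above \<open>K\<close>, take one with the most vertices
  and arcs together. Arcs have to be counted too, because a proper extension may have the same
  vertices.\<close>

lemma (in graph) ex_block_superset:
  assumes "subgraph K G" "two_connected K"
  obtains B where "block_of G B" "subgraph K B"
proof -
  let ?P = "\<lambda>B. subgraph B G \<and> two_connected B \<and> subgraph K B"
  let ?m = "\<lambda>B :: ('a, 'b) pre_digraph. card (verts B) + card (arcs B)"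
  have bound: "\<forall>B. ?P B \<longrightarrow> ?m B < Suc (card (verts G) + card (arcs G))"
    by (auto simp: less_Suc_eq_le subgraph_def intro!: add_mono card_mono)
  have "subgraph K K" using assms(1) by (auto simp: subgraph_def compatible_def)
  then have "?P K" using assms by blast
  then obtain B where B: "?P B" and max: "\<And>C. ?P C \<Longrightarrow> ?m C \<le> ?m B"
    using ex_has_greatest_nat[of ?P K ?m, OF _ bound] by blast
  have "C = B" if C: "subgraph B C" "subgraph C G" "two_connected C" for C
  proof -
    have fin: "finite (verts C)" "finite (arcs C)"
      using C(2) finite_verts finite_arcs by (auto simp: subgraph_def intro: finite_subset)
    have sub: "verts B \<subseteq> verts C" "arcs B \<subseteq> arcs C" "tail C = tail B" "head C = head B"
      using C(1) by (auto simp: subgraph_def compatible_def)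
    have "?P C" using B C subgraph_trans by blast
    then have "?m C \<le> ?m B" by (rule max)
    moreover have "card (verts B) \<le> card (verts C)" "card (arcs B) \<le> card (arcs C)"
      using fin sub by (auto intro: card_mono)
    ultimately have "card (verts C) \<le> card (verts B)" "card (arcs C) \<le> card (arcs B)" by auto
    then have "verts B = verts C" "arcs B = arcs C"
      using fin sub by (simp_all add: card_seteq)
    with sub show ?thesis by simp
  qed
  then have "block_of G B"
    unfolding block_of_def max_subgraph_def using B by blast
  then show ?thesis using B that by blast
qed

text \<open>The path and \<open>v\<close> close up to a cycle, or to a single edge if the path has
  one vertex. Deleting \<open>v\<close> leaves the path. Deleting a path vertex \<open>w\<close>
  leaves at most two pieces of the path, each still attached to \<open>v\<close> by its outer
  end.\<close>

lemma (in graph) two_connected_cycle: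
  assumes p: "vpath p (G \<restriction> (verts G - {v}))"
    and ends: "hd p \<rightarrow>\<^bsub>G\<^esub> v" "last p \<rightarrow>\<^bsub>G\<^esub> v"
  shows "two_connected (G \<restriction> insert v (set p))" (is "two_connected (G \<restriction> ?S)")
proof -
  have "vwalk p (G \<restriction> (verts G - {v}))" and dist: "distinct p"
    using p by (auto simp: vpath_def)
  then have walk: "vwalk p G" and pne: "p \<noteq> []" and pv: "v \<notin> set p"
    by (auto simp: vwalk_def dominates_induce_subgraph_iff)
  have SV: "?S \<subseteq> verts G" using walk ends by (auto simp: vwalk_def adj_in_verts)
  interpret K: graph "G \<restriction> ?S" using SV by (rule graph_induce)
  \<comment> \<open>This is stated for an arbitrary segment \<open>q\<close> and vertex set
    \<open>T\<close>, since it serves both the whole path and the two pieces left after a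
    deletion.\<close>
  have to_v: "a \<rightarrow>\<^sup>*\<^bsub>G \<restriction> T\<^esub> v"
    if "vwalk q G" "e \<in> set q" "a \<in> set q" "e \<rightarrow>\<^bsub>G\<^esub> v" "set q \<subseteq> T" "v \<in> T" "T \<subseteq> verts G"
    for q e a T
  proof -
    interpret T: graph "G \<restriction> T" using that by (intro graph_induce)
    have "a \<rightarrow>\<^sup>*\<^bsub>G \<restriction> T\<^esub> e" using that by (intro reachable_along_vwalk)
    moreover have "e \<rightarrow>\<^bsub>G \<restriction> T\<^esub> v" using that by (auto simp: dominates_induce_subgraph_iff)
    ultimately show ?thesis by (rule T.reachable_adj_trans)
  qed
  have "a \<rightarrow>\<^sup>*\<^bsub>G \<restriction> ?S\<^esub> v" if "a \<in> ?S" for a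
    using that to_v[OF walk, of "hd p" a ?S] pne ends SV by auto
  then have "connected (G \<restriction> ?S)"
    unfolding K.connected_iff_reachable
    by (metis K.reachable_trans K.symmetric_reachable' induce_subgraph_verts insert_not_empty)
  moreover
  have "a \<rightarrow>\<^sup>*\<^bsub>G \<restriction> (?S - {w})\<^esub> b" if w: "w \<in> ?S" and ab: "a \<in> ?S - {w}" "b \<in> ?S - {w}" for w a b
  proof (cases "w = v")
    case True
    then show ?thesis
      using ab pv SV by (intro reachable_along_vwalk[OF walk]) auto
  next
    case False
    let ?T = "?S - {w}"
    have TV: "?T \<subseteq> verts G" using SV by auto
    interpret T: graph "G \<restriction> ?T" using TV by (rule graph_induce)
    obtain xs ys where split: "p = xs @ w # ys"
      using w False split_list[of w p] by auto
    have notin: "w \<notin> set xs" "w \<notin> set ys" using dist split by auto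
    have reach_v: "e \<rightarrow>\<^sup>*\<^bsub>G \<restriction> ?T\<^esub> v" if e: "e \<in> ?T" for e
    proof -
      consider "e = v" | "e \<in> set xs" | "e \<in> set ys"
        using e split by auto
      then show ?thesis
      proof cases
        case 1
        then show ?thesis using e by simp
      next
        case 2
        then have "xs \<noteq> []" by auto
        then have "vwalk xs G" "hd xs = hd p"
          using walk vwalkI_append_l[of xs "w # ys"] split by auto
        then show ?thesis
          using 2 \<open>xs \<noteq> []\<close> False ends notin TV split
          by (intro to_v[of xs "hd p"]) (auto simp flip: \<open>hd xs = hd p\<close>)
      next
        case 3
        then have "ys \<noteq> []" by auto
        then have "vwalk ys G" "last ys = last p"
          using walk vwalkI_append_r[of ys "xs @ [w]"] split by auto
        then show ?thesis
          using 3 \<open>ys \<noteq> []\<close> False ends notin TV split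
          by (intro to_v[of ys "last p"]) (auto simp flip: \<open>last ys = last p\<close>)
      qed
    qed
    show ?thesis
      using reach_v[OF ab(1)] T.symmetric_reachable'[OF reach_v[OF ab(2)]]
      by (rule T.reachable_trans)
  qed
  moreover have "(G \<restriction> ?S) \<restriction> (?S - {w}) = G \<restriction> (?S - {w})" for w
    by (auto simp: induce_subgraph_def)
  ultimately show ?thesis
    unfolding K.two_connected_iff by simp
qed

text \<open>A path from \<open>c\<close> to \<open>z\<close> avoiding \<open>v\<close> would close
  up with \<open>v\<close> to a 2-connected subgraph. The block containing it is complete, which
  would make \<open>c\<close> and \<open>z\<close> adjacent.\<close>

lemma block_graph_separates:
  assumes "block_graph G" and adj: "c \<rightarrow>\<^bsub>G\<^esub> v" "v \<rightarrow>\<^bsub>G\<^esub> z" and nadj: "c \<noteq> z" "\<not> c \<rightarrow>\<^bsub>G\<^esub> z"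
  shows "\<not> c \<rightarrow>\<^sup>*\<^bsub>G \<restriction> (verts G - {v})\<^esub> z"
proof
  interpret graph G using assms(1) by (simp add: block_graph_def)
  interpret D: graph "G \<restriction> (verts G - {v})" by (rule graph_induce) auto
  assume "c \<rightarrow>\<^sup>*\<^bsub>G \<restriction> (verts G - {v})\<^esub> z"
  then obtain p where p: "vpath p (G \<restriction> (verts G - {v}))" "hd p = c" "last p = z"
    using D.reachable_vpath_conv by blast
  then have pne: "p \<noteq> []" "set p \<subseteq> verts G" by (auto simp: vpath_def vwalk_def)
  let ?K = "G \<restriction> insert v (set p)"
  have "two_connected ?K"
    using p adj by (intro two_connected_cycle) (auto intro: adj_sym)
  moreover have "subgraph ?K G"
    using pne adj by (intro subgraph_induce_subgraphI) (auto simp: adj_in_verts)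
  ultimately obtain B where B: "block_of G B" "subgraph ?K B"
    using ex_block_superset by blast
  have "c \<in> set p" "z \<in> set p" using p pne by auto
  then have "c \<in> verts B" "z \<in> verts B" using B(2) by (auto simp: subgraph_def)
  moreover have "complete_digraph (card (verts B)) B"
    using assms(1) B(1) by (simp add: block_graph_def)
  ultimately have "c \<rightarrow>\<^bsub>B\<^esub> z" using nadj(1) by (simp add: complete_digraph_def)
  moreover have "subgraph B G" using B(1) by (simp add: block_of_def max_subgraph_def)
  ultimately show False using nadj(2) adj_mono by blast
qed

text \<open>Converse of \<open>block_graph_separates\<close>. Two nonadjacent vertices in a block
  yield an induced path of three block vertices, and 2-connectedness of the block joins its ends
  around its middle vertex.\<close>

lemma block_graphI:
  assumes "graph G" "connected G"
    and sep: "\<And>u v w. \<lbrakk> u \<rightarrow>\<^bsub>G\<^esub> v; v \<rightarrow>\<^bsub>G\<^esub> w; u \<noteq> w; \<not> u \<rightarrow>\<^bsub>G\<^esub> w \<rbrakk> \<Longrightarrow>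
      \<not> u \<rightarrow>\<^sup>*\<^bsub>G \<restriction> (verts G - {v})\<^esub> w"
  shows "block_graph G"
proof -
  interpret graph G by fact
  have "complete_digraph (card (verts B)) B" if "block_of G B" for B
  proof -
    have sub: "subgraph B G" and tc: "two_connected B"
      and max: "\<And>C. \<lbrakk> subgraph B C; subgraph C G; two_connected C \<rbrakk> \<Longrightarrow> C = B"
      using that by (auto simp: block_of_def max_subgraph_def)
    interpret B: graph B using tc by (simp add: two_connected_def)
    have BV: "verts B \<subseteq> verts G" using sub by (auto simp: subgraph_def)
    have clique: "x \<rightarrow>\<^bsub>G\<^esub> y" if xy: "x \<in> verts B" "y \<in> verts B" "x \<noteq> y" for x y
    proof (rule ccontr)
      assume "\<not> x \<rightarrow>\<^bsub>G\<^esub> y"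
      \<comment> \<open>A walk in \<open>B\<close> from \<open>x\<close> to \<open>y\<close> has to
        leave the closed neighbourhood of \<open>x\<close>. The arc on which it does so gives the
        induced path \<open>x\<close>, \<open>a\<close>, \<open>b\<close>.\<close>
      let ?S = "{a \<in> verts B. a = x \<or> x \<rightarrow>\<^bsub>G\<^esub> a}"
      have "x \<rightarrow>\<^sup>*\<^bsub>B\<^esub> y"
        using tc xy by (auto simp: two_connected_def B.connected_iff_reachable)
      then obtain a b where ab: "a \<in> ?S" "b \<notin> ?S" "a \<rightarrow>\<^bsub>B\<^esub> b"
        by (rule B.reachable_exit[where S = ?S]) (use xy \<open>\<not> x \<rightarrow>\<^bsub>G\<^esub> y\<close> in auto)
      have abG: "a \<rightarrow>\<^bsub>G\<^esub> b" using ab(3) sub adj_mono by blast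
      have b: "b \<in> verts B" "b \<noteq> x" "\<not> x \<rightarrow>\<^bsub>G\<^esub> b"
        using ab B.adj_in_verts by auto
      then have xa: "x \<rightarrow>\<^bsub>G\<^esub> a" using ab abG by auto
      have "a \<noteq> b" "a \<noteq> x" using abG xa adj_irrefl by auto
      then have "x \<rightarrow>\<^sup>*\<^bsub>B \<restriction> (verts B - {a})\<^esub> b"
        using tc ab b xy by (auto simp: B.two_connected_iff)
      then have "x \<rightarrow>\<^sup>*\<^bsub>G \<restriction> (verts G - {a})\<^esub> b"
        using BV arcs_ends_mono[OF sub]
        by (rule_tac reachable_mono_ends) (auto simp: dominates_induce_subgraph_iff)
      then show False using sep[OF xa abG] b by blast
    qed
    \<comment> \<open>So far only adjacency in \<open>G\<close> is known, and \<open>B\<close> might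
      lack some of these arcs. The induced subgraph is a clique, hence 2-connected, and maximality
      identifies \<open>B\<close> with it.\<close>
    let ?K = "G \<restriction> verts B"
    interpret K: graph ?K using BV by (rule graph_induce)
    have ends: "arcs_ends ?K = {(u, v). (u, v) \<in> verts B \<times> verts B \<and> u \<noteq> v}"
      using clique adj_irrefl by (auto simp: dominates_induce_subgraph_iff)
    have "u \<rightarrow>\<^sup>*\<^bsub>?K \<restriction> S\<^esub> v" if S: "S \<subseteq> verts B" "u \<in> S" "v \<in> S" for u v S
    proof -
      interpret S: graph "?K \<restriction> S" using S by (intro K.graph_induce) auto
      have "u = v \<or> u \<rightarrow>\<^bsub>?K \<restriction> S\<^esub> v"
        using S clique by (auto simp: dominates_induce_subgraph_iff)
      then show ?thesis using S by auto
    qed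
    from this[of "verts B - {w}" for w] this[of "verts B"] have "two_connected ?K"
      using tc unfolding K.two_connected_iff K.connected_iff_reachable
      by (auto simp: two_connected_def B.connected_iff_reachable induce_subgraph_def)
    moreover have "subgraph B ?K" using sub by (rule subgraph_induce_subgraphI2)
    moreover have "subgraph ?K G" using BV by (rule subgraph_induce_subgraphI)
    ultimately have "?K = B" by (intro max)
    then show ?thesis
      using ends B.graph_axioms by (simp add: complete_digraph_def)
  qed
  then show ?thesis using assms(1,2) by (simp add: block_graph_def)
qed


section \<open>Distances\<close>

context wf_digraph
begin

lemma awalk_cost_one: "awalk_cost (\<lambda>_. 1) p = real (length p)"
  by (induct p) auto

text \<open>A natural-number version of \<open>gdist\<close>, which keeps the later arithmetic out
  of \<open>ereal\<close>. Its value is unspecified for pairs joined by no walk.\<close>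

definition hop_dist :: "'a \<Rightarrow> 'a \<Rightarrow> nat" where
  "hop_dist u v = (LEAST n. \<exists>p. awalk u p v \<and> length p = n)"

lemma hop_dist_le: "awalk u p v \<Longrightarrow> hop_dist u v \<le> length p"
  unfolding hop_dist_def by (rule Least_le) blast

lemma ex_hop_dist_awalk:
  assumes "u \<rightarrow>\<^sup>*\<^bsub>G\<^esub> v"
  obtains p where "awalk u p v" "length p = hop_dist u v"
proof -
  have "\<exists>n p. awalk u p v \<and> length p = n" using assms by (simp add: reachable_awalk)
  then have "\<exists>p. awalk u p v \<and> length p = hop_dist u v"
    unfolding hop_dist_def by (rule LeastI_ex)
  then show ?thesis using that by blast
qed

lemma gdist_eq_hop_dist:
  assumes "u \<rightarrow>\<^sup>*\<^bsub>G\<^esub> v"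
  shows "gdist G u v = ereal (real (hop_dist u v))"
proof (rule antisym)
  obtain p where p: "awalk u p v" "length p = hop_dist u v"
    using assms by (rule ex_hop_dist_awalk)
  then show "gdist G u v \<le> ereal (real (hop_dist u v))"
    unfolding gdist_def using min_cost_le_walk_cost[of u p v "\<lambda>_. 1"] by (simp add: awalk_cost_one)
  show "ereal (real (hop_dist u v)) \<le> gdist G u v"
    unfolding gdist_def \<mu>_def by (rule INF_greatest) (auto simp: awalk_cost_one hop_dist_le)
qed

end

section \<open>The metric of a connected graph\<close>

locale connected_graph = graph +
  assumes connected: "connected G"
begin

abbreviation "d \<equiv> hop_dist"

lemma reachable_verts: "u \<in> verts G \<Longrightarrow> v \<in> verts G \<Longrightarrow> u \<rightarrow>\<^sup>*\<^bsub>G\<^esub> v"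
  using connected connected_iff_reachable by blast

lemma d_zero_iff:
  assumes "u \<in> verts G" "v \<in> verts G"
  shows "d u v = 0 \<longleftrightarrow> u = v"
proof
  assume "d u v = 0"
  then show "u = v"
    using ex_hop_dist_awalk[OF reachable_verts[OF assms]] by (metis awalk_Nil_iff length_0_conv)
next
  assume "u = v"
  then show "d u v = 0" using hop_dist_le[of u "[]" v] assms by (simp add: awalk_Nil_iff)
qed

lemma d_triangle:
  assumes "u \<in> verts G" "v \<in> verts G" "w \<in> verts G"
  shows "d u w \<le> d u v + d v w"
proof -
  obtain p q where "awalk u p v" "length p = d u v" "awalk v q w" "length q = d v w"
    using ex_hop_dist_awalk reachable_verts assms by metis
  then show ?thesis using hop_dist_le[of u "p @ q" w] awalk_appendI by fastforce
qed

lemma d_adj_le_one: "u \<rightarrow>\<^bsub>G\<^esub> v \<Longrightarrow> d u v \<le> 1"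
  by (erule reachableE) (use arc_implies_awalk hop_dist_le[of u "[_]" v] in auto)

lemma d_adj_le:
  assumes "u \<rightarrow>\<^bsub>G\<^esub> w" "v \<in> verts G"
  shows "d u v \<le> Suc (d w v)"
  using d_triangle[of u w v] d_adj_le_one[OF assms(1)] adj_in_verts[OF assms(1)] assms(2) by simp

lemma d_SucE:
  assumes "d u v = Suc n" "u \<in> verts G" "v \<in> verts G"
  obtains w where "u \<rightarrow>\<^bsub>G\<^esub> w" "d w v = n"
proof -
  obtain p where p: "awalk u p v" "length p = Suc n"
    using ex_hop_dist_awalk reachable_verts assms by metis
  then obtain e q where eq: "p = e # q" by (cases p) auto
  then have e: "e \<in> arcs G" "tail G e = u" "awalk (head G e) q v" "length q = n"
    using p by (auto simp: awalk_Cons_iff)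
  then have adj: "u \<rightarrow>\<^bsub>G\<^esub> head G e" using in_arcs_imp_in_arcs_ends by blast
  have "d (head G e) v \<le> n" using hop_dist_le e by blast
  then have "d (head G e) v = n" using d_adj_le[OF adj assms(3)] assms(1) by simp
  with adj show ?thesis by (rule that)
qed

text \<open>Walks are directed, so symmetry of the distance is derived from symmetry of the arcs, by
  peeling off the first arc of a shortest walk.\<close>

lemma d_sym_le:
  assumes "u \<in> verts G" "v \<in> verts G"
  shows "d v u \<le> d u v"
  using assms
proof (induct "d u v" arbitrary: u)
  case 0
  then show ?case using d_zero_iff[of u v] d_zero_iff[of v u] by simp
next
  case (Suc n)
  then obtain w where w: "u \<rightarrow>\<^bsub>G\<^esub> w" "d w v = n" by (metis d_SucE)
  then have wV: "w \<in> verts G" using adj_in_verts by blast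
  then have "d v w \<le> n" using Suc w by metis
  moreover have "d w u \<le> 1" using w adj_sym d_adj_le_one by blast
  ultimately show ?case using d_triangle[of v w u] Suc wV by simp
qed

lemma d_sym: "u \<in> verts G \<Longrightarrow> v \<in> verts G \<Longrightarrow> d v u = d u v"
  using d_sym_le by (metis antisym)

lemma d_adj: "u \<rightarrow>\<^bsub>G\<^esub> v \<Longrightarrow> d u v = 1"
  using d_adj_le_one[of u v] d_zero_iff[of u v] adj_in_verts[of u v] adj_irrefl[of u]
  by (cases "d u v") auto

lemma d_ge_two_iff:
  assumes "u \<in> verts G" "v \<in> verts G"
  shows "2 \<le> d u v \<longleftrightarrow> u \<noteq> v \<and> \<not> u \<rightarrow>\<^bsub>G\<^esub> v"
proof
  assume "2 \<le> d u v"
  then show "u \<noteq> v \<and> \<not> u \<rightarrow>\<^bsub>G\<^esub> v" using d_adj d_zero_iff assms by fastforce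
next
  assume R: "u \<noteq> v \<and> \<not> u \<rightarrow>\<^bsub>G\<^esub> v"
  then obtain n where n: "d u v = Suc n" using d_zero_iff assms not0_implies_Suc by blast
  then obtain w where w: "u \<rightarrow>\<^bsub>G\<^esub> w" "d w v = n" using assms by (rule d_SucE)
  then have "n \<noteq> 0" using R d_zero_iff assms adj_in_verts by blast
  then show "2 \<le> d u v" using n by simp
qed

text \<open>All vertices are mutually reachable, so every distance is a natural number, and d(c,c')
  = 1 turns the first alternative into a successor.\<close>

lemma property_P2_iff:
  "property_P2 G \<longleftrightarrow> (\<forall>c c' x y. c \<rightarrow>\<^bsub>G\<^esub> c' \<longrightarrow> x \<in> verts G \<longrightarrow> y \<in> verts G \<longrightarrow>
     d c x = Suc (d c' x) \<longrightarrow> 2 \<le> d c x \<longrightarrow> 2 \<le> d c' y \<longrightarrow>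
     d c y = Suc (d c' y) \<or> d x y = d x c' + d c' y)"
proof -
  have gd: "gdist G u v = ereal (real (d u v))" if "u \<in> verts G" "v \<in> verts G" for u v
    using that reachable_verts gdist_eq_hop_dist by blast
  have two: "2 \<le> gdist G u v \<longleftrightarrow> 2 \<le> d u v" if "u \<in> verts G" "v \<in> verts G" for u v
    using gd[OF that] by (metis ereal_less_eq(3) numeral_eq_ereal of_nat_le_iff of_nat_numeral)
  have suc: "gdist G a x = 1 + gdist G b y \<longleftrightarrow> d a x = Suc (d b y)"
    if "a \<in> verts G" "b \<in> verts G" "x \<in> verts G" "y \<in> verts G" for a b x y
    using gd[OF that(1,3)] gd[OF that(2,4)] by (auto simp: one_ereal_def)
  have add: "gdist G x y = gdist G x c' + gdist G c' y \<longleftrightarrow> d x y = d x c' + d c' y"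
    if "x \<in> verts G" "y \<in> verts G" "c' \<in> verts G" for x y c'
    using gd that by (simp flip: of_nat_add)
  have one: "gdist G c c' = 1" if "c \<rightarrow>\<^bsub>G\<^esub> c'" for c c'
    using gd[of c c'] d_adj[OF that] adj_in_verts[OF that] by (simp add: one_ereal_def)
  have pointwise: "(gdist G c x = 1 + gdist G c' x \<longrightarrow> gdist G c x \<ge> 2 \<and> gdist G c' y \<ge> 2 \<longrightarrow>
        gdist G c y = gdist G c c' + gdist G c' y \<or> gdist G x y = gdist G x c' + gdist G c' y) \<longleftrightarrow>
      (d c x = Suc (d c' x) \<longrightarrow> 2 \<le> d c x \<longrightarrow> 2 \<le> d c' y \<longrightarrow>
        d c y = Suc (d c' y) \<or> d x y = d x c' + d c' y)"
    if "c \<rightarrow>\<^bsub>G\<^esub> c'" "x \<in> verts G" "y \<in> verts G" for c c' x y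
  proof -
    have V: "c \<in> verts G" "c' \<in> verts G" using that adj_in_verts by auto
    show ?thesis
      unfolding one[OF that(1)] suc[OF V that(2,2)] suc[OF V that(3,3)]
        two[OF V(1) that(2)] two[OF V(2) that(3)] add[OF that(2,3) V(2)]
      by blast
  qed
  have "property_P2 G \<longleftrightarrow> (\<forall>c c' x y. c \<rightarrow>\<^bsub>G\<^esub> c' \<longrightarrow> x \<in> verts G \<longrightarrow> y \<in> verts G \<longrightarrow>
      gdist G c x = 1 + gdist G c' x \<longrightarrow> gdist G c x \<ge> 2 \<and> gdist G c' y \<ge> 2 \<longrightarrow>
      gdist G c y = gdist G c c' + gdist G c' y \<or> gdist G x y = gdist G x c' + gdist G c' y)"
    unfolding property_P2_def nbrs_towards_def nbrs_def using adj_in_verts(1) by blast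
  also have "\<dots> \<longleftrightarrow> (\<forall>c c' x y. c \<rightarrow>\<^bsub>G\<^esub> c' \<longrightarrow> x \<in> verts G \<longrightarrow> y \<in> verts G \<longrightarrow>
      d c x = Suc (d c' x) \<longrightarrow> 2 \<le> d c x \<longrightarrow> 2 \<le> d c' y \<longrightarrow>
      d c y = Suc (d c' y) \<or> d x y = d x c' + d c' y)"
    by (intro iff_allI imp_cong[OF refl] pointwise)
  finally show ?thesis .
qed

lemma property_P2D:
  assumes "property_P2 G" "c \<rightarrow>\<^bsub>G\<^esub> c'" "x \<in> verts G" "y \<in> verts G"
    and "d c x = Suc (d c' x)" "2 \<le> d c x" "2 \<le> d c' y"
  shows "d c y = Suc (d c' y) \<or> d x y = d x c' + d c' y"
  using iffD1[OF property_P2_iff assms(1), THEN spec, THEN spec, THEN spec, THEN spec, of c c' x y]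
    assms(2-) by simp

section \<open>From (P2) to a block graph\<close>

definition cnbrs :: "'a \<Rightarrow> 'a set" where
  "cnbrs u = insert u {w. u \<rightarrow>\<^bsub>G\<^esub> w}"

definition simplicial :: "'a \<Rightarrow> bool" where
  "simplicial u \<longleftrightarrow> (\<forall>a \<in> cnbrs u. \<forall>b \<in> cnbrs u. a \<noteq> b \<longrightarrow> a \<rightarrow>\<^bsub>G\<^esub> b)"

text \<open>Twins that are not simplicial share one representative, as the choice depends only on
  \<open>cnbrs u\<close>. Simplicial vertices stay fixed even if they have twins: they need not
  become cut vertices, and a non-cut vertex must have a one-element fibre.\<close>

definition twin_rep :: "'a \<Rightarrow> 'a" where
  "twin_rep u = (if simplicial u then u else SOME w. cnbrs w = cnbrs u)"

lemma in_cnbrs_sym: "a \<in> cnbrs b \<longleftrightarrow> b \<in> cnbrs a"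
  unfolding cnbrs_def using adj_sym by blast

lemma cnbrs_self: "a \<in> cnbrs a"
  by (simp add: cnbrs_def)

lemma cnbrs_twin_rep: "cnbrs (twin_rep u) = cnbrs u"
proof (cases "simplicial u")
  case True
  then show ?thesis by (simp add: twin_rep_def)
next
  case False
  have "cnbrs (SOME w. cnbrs w = cnbrs u) = cnbrs u" by (rule someI) (rule refl)
  with False show ?thesis unfolding twin_rep_def by (simp only: if_False)
qed

lemma simplicial_cong: "cnbrs u = cnbrs w \<Longrightarrow> simplicial u = simplicial w"
  by (simp add: simplicial_def)

lemma twin_rep_eq: "cnbrs u = cnbrs w \<Longrightarrow> \<not> simplicial w \<Longrightarrow> twin_rep u = twin_rep w"
  using simplicial_cong[of u w] by (simp add: twin_rep_def)

lemma twin_rep_idem: "twin_rep (twin_rep u) = twin_rep u"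
proof (cases "simplicial u")
  case True
  then show ?thesis by (simp add: twin_rep_def)
next
  case False
  then show ?thesis by (intro twin_rep_eq cnbrs_twin_rep)
qed

text \<open>The choice ranges over the whole type. The chosen element is nevertheless a vertex,
  since it equals \<open>u\<close> or is adjacent to \<open>u\<close>.\<close>

lemma twin_rep_in_verts: "u \<in> verts G \<Longrightarrow> twin_rep u \<in> verts G"
proof -
  assume u: "u \<in> verts G"
  have "u \<in> cnbrs (twin_rep u)" by (simp add: cnbrs_twin_rep cnbrs_self)
  then show ?thesis using u adj_in_verts by (auto simp: cnbrs_def)
qed

lemma twin_rep_in_cnbrs: "twin_rep u \<in> cnbrs (twin_rep w) \<longleftrightarrow> u \<in> cnbrs w"
  using in_cnbrs_sym[of "twin_rep u" w] in_cnbrs_sym[of w u] by (simp add: cnbrs_twin_rep)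

text \<open>Used in both directions, this makes any two common neighbours of \<open>c\<close> and
  \<open>x\<close> true twins.\<close>

lemma P2_common_nbrs:
  assumes P2: "property_P2 G"
    and cx: "c \<noteq> x" "\<not> c \<rightarrow>\<^bsub>G\<^esub> x"
    and v: "c \<rightarrow>\<^bsub>G\<^esub> v" "v \<rightarrow>\<^bsub>G\<^esub> x" and y: "c \<rightarrow>\<^bsub>G\<^esub> y" "y \<rightarrow>\<^bsub>G\<^esub> x"
  shows "cnbrs v \<subseteq> cnbrs y"
proof
  fix z assume z: "z \<in> cnbrs v"
  have V: "c \<in> verts G" "x \<in> verts G" "y \<in> verts G" "v \<in> verts G" "z \<in> verts G"
    using v y z adj_in_verts by (auto simp: cnbrs_def)
  show "z \<in> cnbrs y"
  proof (rule ccontr)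
    assume "z \<notin> cnbrs y"
    then have yz: "2 \<le> d y z" using V by (auto simp: d_ge_two_iff cnbrs_def)
    have vz: "d v z \<le> 1" using z V d_adj_le_one[of v z] d_zero_iff[of v v] by (auto simp: cnbrs_def)
    have "d c x = Suc (d y x)" "2 \<le> d c x"
    proof -
      show "2 \<le> d c x" using cx V by (simp add: d_ge_two_iff)
      moreover have "d c x \<le> Suc (d y x)" using y V by (intro d_adj_le)
      ultimately show "d c x = Suc (d y x)" using d_adj[OF y(2)] by simp
    qed
    \<comment> \<open>(P2) with \<open>y\<close> as c' puts \<open>z\<close> at distance at least 3
      from \<open>c\<close> or from \<open>x\<close>. But \<open>z\<close> is within distance 2 of
      both through \<open>v\<close>.\<close>
    then have "d c z = Suc (d y z) \<or> d x z = d x y + d y z"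
      using property_P2D[OF P2 y(1), of x z] V yz by blast
    moreover have "d c z \<le> Suc (d v z)" "d x z \<le> Suc (d v z)"
      using v V adj_sym[OF v(2)] by (auto intro: d_adj_le)
    moreover have "d x y = 1" using y adj_sym d_adj by blast
    ultimately show False using yz vz by auto
  qed
qed

text \<open>The set \<open>?S\<close> contains \<open>c\<close> but not \<open>x\<close>, so a walk
  from \<open>c\<close> to \<open>x\<close> leaves it on some arc from \<open>y\<close> to
  \<open>z\<close>. If \<open>y\<close> is far from \<open>v\<close>, (P2) rules this arc out. If
  \<open>y\<close> is close to \<open>v\<close>, it turns out to be a twin of
  \<open>v\<close>.\<close>

lemma P2_separates:
  assumes P2: "property_P2 G"
    and cx: "c \<noteq> x" "\<not> c \<rightarrow>\<^bsub>G\<^esub> x" and v: "c \<rightarrow>\<^bsub>G\<^esub> v" "v \<rightarrow>\<^bsub>G\<^esub> x"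
  shows "\<not> c \<rightarrow>\<^sup>*\<^bsub>G \<restriction> (verts G - {u. cnbrs u = cnbrs v})\<^esub> x"
proof
  let ?F = "{u. cnbrs u = cnbrs v}"
  let ?S = "{y. d c y \<le> d v y}"
  interpret D: graph "G \<restriction> (verts G - ?F)" by (rule graph_induce) auto
  have V: "c \<in> verts G" "x \<in> verts G" "v \<in> verts G"
    using v adj_in_verts by auto
  assume "c \<rightarrow>\<^sup>*\<^bsub>G \<restriction> (verts G - ?F)\<^esub> x"
  moreover have "c \<in> ?S" using V d_zero_iff[of c c] by simp
  moreover have "x \<notin> ?S"
    using d_adj[OF v(2)] cx V d_ge_two_iff[of c x] by simp
  ultimately obtain y z where "y \<in> ?S" "z \<notin> ?S" "y \<rightarrow>\<^bsub>G \<restriction> (verts G - ?F)\<^esub> z"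
    by (rule D.reachable_exit)
  then have yz: "d c y \<le> d v y" "d v z < d c z" "y \<rightarrow>\<^bsub>G\<^esub> z"
    and yF: "cnbrs y \<noteq> cnbrs v" and zF: "cnbrs z \<noteq> cnbrs v"
    by (auto simp: dominates_induce_subgraph_iff)
  have V': "y \<in> verts G" "z \<in> verts G" using yz adj_in_verts by auto
  have cz: "d c z = Suc (d v z)" using yz d_adj_le[OF v(1), of z] V' by simp
  \<comment> \<open>This ensures d(c,z) \<ge> 2, so that \<open>z\<close> can play the role of x in
    (P2).\<close>
  have vz: "d v z \<noteq> 0" using zF d_zero_iff V V' by metis
  have zy: "d z y = 1" using yz adj_sym d_adj by blast
  show False
  proof (cases "2 \<le> d v y")
    case True
    \<comment> \<open>The first alternative contradicts that \<open>y\<close> lies in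
      \<open>?S\<close>, the second that \<open>y\<close> and \<open>z\<close> are adjacent.\<close>
    then have "d c y = Suc (d v y) \<or> d z y = d z v + d v y"
      using property_P2D[OF P2 v(1), of z y] V' cz vz by simp
    then show False using yz True zy by auto
  next
    case False
    then have vy: "v \<rightarrow>\<^bsub>G\<^esub> y" using yF V V' d_ge_two_iff by metis
    have "c = y \<or> c \<rightarrow>\<^bsub>G\<^esub> y" using yz(1) False V V' d_ge_two_iff[of c y] by auto
    moreover have c_z: "c \<noteq> z" "\<not> c \<rightarrow>\<^bsub>G\<^esub> z"
      using cz vz V V' d_ge_two_iff[of c z] by auto
    \<comment> \<open>Now \<open>v\<close> and \<open>y\<close> both turn out to be common
      neighbours of the nonadjacent vertices \<open>c\<close> and \<open>z\<close>, hence twins,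
      although the walk avoids the twins of \<open>v\<close>.\<close>
    ultimately have cy: "c \<rightarrow>\<^bsub>G\<^esub> y" using yz by auto
    have "d c z \<le> Suc (d y z)" using cy V' by (intro d_adj_le)
    then have "d v z \<le> 1" using cz yz(3) d_adj_le_one by fastforce
    then have "v \<rightarrow>\<^bsub>G\<^esub> z" using vz V V' d_ge_two_iff[of v z] d_zero_iff[of v z] by auto
    then have "cnbrs y = cnbrs v"
      using P2_common_nbrs[OF P2 c_z] v cy yz by blast
    then show False using yF by simp
  qed
qed

text \<open>The quotient is realised inside \<open>G\<close>, on the representatives. Arcs are pairs
  of vertices because \<open>extended_block_graph\<close> asks for a block graph of this
  type.\<close>

definition twin_quotient :: "('a, 'a \<times> 'a) pre_digraph" where
  "twin_quotient = \<lparr> verts = twin_rep ` verts G,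
     arcs = {(a, b) \<in> twin_rep ` verts G \<times> twin_rep ` verts G. a \<rightarrow>\<^bsub>G\<^esub> b},
     tail = fst, head = snd \<rparr>"

lemma verts_twin_quotient: "verts twin_quotient = twin_rep ` verts G"
  by (simp add: twin_quotient_def)

lemma dominates_twin_quotient:
  "a \<rightarrow>\<^bsub>twin_quotient\<^esub> b \<longleftrightarrow> a \<in> verts twin_quotient \<and> b \<in> verts twin_quotient \<and> a \<rightarrow>\<^bsub>G\<^esub> b"
  by (auto simp: twin_quotient_def arcs_ends_conv image_iff)

lemma verts_twin_quotient_subset: "verts twin_quotient \<subseteq> verts G"
  using twin_rep_in_verts by (auto simp: verts_twin_quotient)

lemma twin_rep_verts_twin_quotient: "v \<in> verts twin_quotient \<Longrightarrow> twin_rep v = v"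
  using twin_rep_idem by (auto simp: verts_twin_quotient)

lemma graph_twin_quotient: "graph twin_quotient"
proof -
  have "arcs twin_quotient \<subseteq> verts twin_quotient \<times> verts twin_quotient"
    by (auto simp: twin_quotient_def)
  moreover have "finite (verts twin_quotient)" by (simp add: verts_twin_quotient)
  ultimately have fin: "finite (arcs twin_quotient)" by (auto intro: finite_subset)
  interpret D: digraph twin_quotient
  proof
    show "finite (arcs twin_quotient)" by (rule fin)
  qed (use adj_irrefl in \<open>auto simp: twin_quotient_def arc_to_ends_def\<close>)
  have "symmetric twin_quotient"
    unfolding symmetric_def by (rule symI) (auto simp: dominates_twin_quotient adj_sym)
  then show ?thesis by (rule D.graphI)
qed

lemma adj_iff_twin_rep:
  assumes "u \<in> verts G" "w \<in> verts G"
  shows "u \<rightarrow>\<^bsub>G\<^esub> w \<longleftrightarrow>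
    u \<noteq> w \<and> (twin_rep u = twin_rep w \<or> twin_rep u \<rightarrow>\<^bsub>twin_quotient\<^esub> twin_rep w)"
proof -
  have "u \<rightarrow>\<^bsub>G\<^esub> w \<longleftrightarrow> u \<noteq> w \<and> w \<in> cnbrs u" using adj_irrefl by (auto simp: cnbrs_def)
  also have "w \<in> cnbrs u \<longleftrightarrow> twin_rep w \<in> cnbrs (twin_rep u)" by (simp add: twin_rep_in_cnbrs)
  finally show ?thesis
    using assms by (auto simp: cnbrs_def dominates_twin_quotient verts_twin_quotient)
qed

text \<open>Under \<open>twin_rep\<close>, each step of a walk in \<open>G\<close> either stays in
  place or becomes an arc of the quotient.\<close>

lemma connected_twin_quotient: "connected twin_quotient"
proof -
  interpret H: graph twin_quotient by (rule graph_twin_quotient)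
  have "twin_rep u \<rightarrow>\<^sup>*\<^bsub>twin_quotient\<^esub> twin_rep w" if "u \<rightarrow>\<^sup>*\<^bsub>G\<^esub> w" for u w
    using that
  proof (induct rule: reachable_induct)
    case base
    then show ?case by (auto simp: verts_twin_quotient)
  next
    case (step x y)
    then have "twin_rep x = twin_rep y \<or> twin_rep x \<rightarrow>\<^bsub>twin_quotient\<^esub> twin_rep y"
      using adj_iff_twin_rep adj_in_verts by blast
    then show ?case using step(3) by (auto intro: H.reachable_adj_trans)
  qed
  then show ?thesis
    using connected connected_iff_reachable
    unfolding H.connected_iff_reachable by (auto simp: verts_twin_quotient)
qed

text \<open>As the middle of an induced path, \<open>v\<close> is not simplicial, so it is the only
  quotient vertex in its twin class. A walk in the quotient avoiding \<open>v\<close> therefore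
  avoids the whole class in \<open>G\<close>, and \<open>P2_separates\<close> applies.\<close>

lemma P2_twin_quotient_separates:
  assumes P2: "property_P2 G"
    and v: "v \<in> verts twin_quotient" "u \<rightarrow>\<^bsub>G\<^esub> v" "v \<rightarrow>\<^bsub>G\<^esub> w" and uw: "u \<noteq> w" "\<not> u \<rightarrow>\<^bsub>G\<^esub> w"
  shows "\<not> u \<rightarrow>\<^sup>*\<^bsub>twin_quotient \<restriction> (verts twin_quotient - {v})\<^esub> w"
proof
  assume R: "u \<rightarrow>\<^sup>*\<^bsub>twin_quotient \<restriction> (verts twin_quotient - {v})\<^esub> w"
  let ?F = "{u. cnbrs u = cnbrs v}"
  have "\<not> simplicial v"
    using v uw adj_sym[OF v(2)] by (auto simp: simplicial_def cnbrs_def)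
  then have "a = v" if "a \<in> verts twin_quotient" "a \<in> ?F" for a
    using that v(1) twin_rep_eq[of a v] twin_rep_verts_twin_quotient by simp
  then have "verts twin_quotient - {v} \<subseteq> verts G - ?F"
    using verts_twin_quotient_subset by auto
  then have "u \<rightarrow>\<^sup>*\<^bsub>G \<restriction> (verts G - ?F)\<^esub> w"
    using R by (rule_tac reachable_mono_ends)
      (auto simp: dominates_induce_subgraph_iff dominates_twin_quotient)
  then show False using P2_separates[OF P2 uw v(2,3)] by contradiction
qed

lemma P2_imp_block_graph_twin_quotient:
  assumes "property_P2 G"
  shows "block_graph twin_quotient"
  using graph_twin_quotient connected_twin_quotient
proof (rule block_graphI)
  fix u v w
  assume "u \<rightarrow>\<^bsub>twin_quotient\<^esub> v" "v \<rightarrow>\<^bsub>twin_quotient\<^esub> w" "u \<noteq> w"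
    and "\<not> u \<rightarrow>\<^bsub>twin_quotient\<^esub> w"
  then show "\<not> u \<rightarrow>\<^sup>*\<^bsub>twin_quotient \<restriction> (verts twin_quotient - {v})\<^esub> w"
    unfolding dominates_twin_quotient by (intro P2_twin_quotient_separates assms) simp_all
qed

lemma P2_imp_blow_up_via_twin_rep:
  assumes P2: "property_P2 G"
  shows "blow_up_via twin_quotient G twin_rep"
proof -
  interpret H: graph twin_quotient by (rule graph_twin_quotient)
  have "\<exists>!u. u \<in> verts G \<and> twin_rep u = v"
    if v: "v \<in> verts twin_quotient" and nc: "\<not> cut_vertex twin_quotient v" for v
  proof -
    have vG: "v \<in> verts G" "twin_rep v = v"
      using v verts_twin_quotient_subset twin_rep_verts_twin_quotient by auto
    \<comment> \<open>Otherwise \<open>v\<close> is the middle of an induced path, and its removal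
      from the quotient would separate the ends, making it a cut vertex.\<close>
    have "simplicial v"
    proof (rule ccontr)
      assume "\<not> simplicial v"
      then obtain a b where ab: "a \<in> cnbrs v" "b \<in> cnbrs v" "b \<notin> cnbrs a"
        unfolding simplicial_def cnbrs_def by blast
      \<comment> \<open>The ends are replaced by representatives to lie in the quotient. The path
        stays induced since closed neighbourhoods are unchanged.\<close>
      let ?a = "twin_rep a" and ?b = "twin_rep b"
      have cl: "?a \<in> cnbrs v" "?b \<in> cnbrs v" "?b \<notin> cnbrs ?a"
        using ab twin_rep_in_cnbrs[of _ v] twin_rep_in_cnbrs[of b a] vG(2) by auto
      then have adj: "?a \<rightarrow>\<^bsub>G\<^esub> v" "v \<rightarrow>\<^bsub>G\<^esub> ?b" "?a \<noteq> ?b" "\<not> ?a \<rightarrow>\<^bsub>G\<^esub> ?b" "?a \<noteq> v" "?b \<noteq> v"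
        using in_cnbrs_sym[of ?a v] in_cnbrs_sym[of ?a ?b] in_cnbrs_sym[of ?b v]
        unfolding cnbrs_def by auto
      have "a \<in> verts G" "b \<in> verts G" using ab vG adj_in_verts by (auto simp: cnbrs_def)
      then have H: "?a \<in> verts twin_quotient" "?b \<in> verts twin_quotient"
        by (auto simp: verts_twin_quotient)
      have "?a \<rightarrow>\<^sup>*\<^bsub>twin_quotient\<^esub> ?b"
        using H connected_twin_quotient H.connected_iff_reachable by blast
      moreover have "\<not> ?a \<rightarrow>\<^sup>*\<^bsub>twin_quotient \<restriction> (verts twin_quotient - {v})\<^esub> ?b"
        using P2_twin_quotient_separates[OF P2 v] adj by blast
      ultimately show False
        using nc v H adj unfolding cut_vertex_def H.del_vert_eq_induce by blast
    qed
    then have "u = v" if "twin_rep u = v" for u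
      using that cnbrs_twin_rep[of u] simplicial_cong[of u v] by (simp add: twin_rep_def)
    then show ?thesis using vG by blast
  qed
  then show ?thesis
    unfolding blow_up_via_def using adj_iff_twin_rep verts_twin_quotient by blast
qed

section \<open>From a blow-up to (P2)\<close>

text \<open>Follow a shortest walk from \<open>a\<close>. As long as it stays outside
  \<open>F\<close>, its current vertex is still separated from \<open>y\<close>, so it must enter
  \<open>F\<close>, and the entry point lies on a geodesic.\<close>

lemma geodesic_meets_separator:
  assumes "a \<in> verts G - F" "y \<in> verts G - F" "\<not> a \<rightarrow>\<^sup>*\<^bsub>G \<restriction> (verts G - F)\<^esub> y"
  obtains u where "u \<in> F" "u \<in> verts G" "d a y = d a u + d u y"
proof -
  interpret D: graph "G \<restriction> (verts G - F)" by (rule graph_induce) auto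
  have "\<exists>u. u \<in> F \<and> u \<in> verts G \<and> d a y = d a u + d u y"
    using assms
  proof (induct "d a y" arbitrary: a)
    case 0
    then have "a = y" using d_zero_iff by (metis DiffD1)
    then show ?case using 0 by auto
  next
    case (Suc n)
    obtain b where b: "a \<rightarrow>\<^bsub>G\<^esub> b" "d b y = n"
      by (rule d_SucE[of a y n]) (use Suc in auto)
    then have bV: "b \<in> verts G" using adj_in_verts by blast
    show ?case
    proof (cases "b \<in> F")
      case True
      then show ?thesis using b bV Suc(2) d_adj[OF b(1)] by auto
    next
      case False
      then have "a \<rightarrow>\<^bsub>G \<restriction> (verts G - F)\<^esub> b"
        using b(1) bV Suc(3) by (simp add: dominates_induce_subgraph_iff)
      then have "\<not> b \<rightarrow>\<^sup>*\<^bsub>G \<restriction> (verts G - F)\<^esub> y"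
        using Suc(5) D.adj_reachable_trans by blast
      then obtain u where u: "u \<in> F" "u \<in> verts G" "d b y = d b u + d u y"
        using Suc(1)[of b] b bV False Suc(4) by auto
      moreover have "d a u \<le> Suc (d b u)" using b(1) u(2) by (rule d_adj_le)
      moreover have "d a y \<le> d a u + d u y" using Suc u d_triangle by auto
      ultimately show ?thesis using Suc(2) b(2) by force
    qed
  qed
  then show ?thesis using that by blast
qed

text \<open>Distances to \<open>x\<close> decrease along a shortest walk from \<open>t\<close>, so
  they stay below \<open>k\<close> and the walk never meets \<open>F\<close>.\<close>

lemma reachable_below:
  assumes "t \<in> verts G" "x \<in> verts G" "d t x < k" "\<And>u. u \<in> F \<Longrightarrow> u \<in> verts G \<Longrightarrow> k \<le> d u x"
  shows "t \<rightarrow>\<^sup>*\<^bsub>G \<restriction> (verts G - F)\<^esub> x"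
  using assms(1,3)
proof (induct "d t x" arbitrary: t)
  case 0
  interpret D: graph "G \<restriction> (verts G - F)" by (rule graph_induce) auto
  have "t = x" "t \<notin> F" using 0 assms d_zero_iff by (metis, fastforce)
  then show ?case using 0 by auto
next
  case (Suc n)
  interpret D: graph "G \<restriction> (verts G - F)" by (rule graph_induce) auto
  obtain b where b: "t \<rightarrow>\<^bsub>G\<^esub> b" "d b x = n"
    by (rule d_SucE[of t x n]) (use Suc assms in auto)
  have bV: "b \<in> verts G" using b adj_in_verts by blast
  have "t \<notin> F" "b \<notin> F" using assms(4)[of t] assms(4)[of b] Suc bV b by auto
  then have "t \<rightarrow>\<^bsub>G \<restriction> (verts G - F)\<^esub> b"
    using b bV Suc by (simp add: dominates_induce_subgraph_iff)
  moreover have "b \<rightarrow>\<^sup>*\<^bsub>G \<restriction> (verts G - F)\<^esub> x"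
    using Suc b bV by auto
  ultimately show ?case by (rule D.adj_reachable_trans)
qed

text \<open>The fibre \<open>?F\<close> of \<open>c'\<close> separates \<open>c\<close> from
  \<open>x\<close>, hence separates \<open>y\<close> from at least one of them. A geodesic from that
  vertex to \<open>y\<close> passes through \<open>?F\<close>, whose members all have the same
  distances to vertices outside it.\<close>

lemma blow_up_imp_P2:
  assumes H: "block_graph H" and bu: "blow_up_via H G f"
  shows "property_P2 G"
  unfolding property_P2_iff
proof (intro allI impI)
  have fV: "f u \<in> verts H" if "u \<in> verts G" for u
    using bu that unfolding blow_up_via_def by blast
  have adj: "u \<rightarrow>\<^bsub>G\<^esub> w \<longleftrightarrow> u \<noteq> w \<and> (f u = f w \<or> f u \<rightarrow>\<^bsub>H\<^esub> f w)"
    if "u \<in> verts G" "w \<in> verts G" for u w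
    using bu that unfolding blow_up_via_def by blast
  \<comment> \<open>The second vertex of a geodesic from \<open>u'\<close> is equal or adjacent to
    \<open>u\<close>. The case \<open>u' = y\<close> is excluded, since there is no first step
    then.\<close>
  have twin_le: "d u y \<le> d u' y"
    if V: "u \<in> verts G" "u' \<in> verts G" "y \<in> verts G" and eq: "f u = f u'" and ne: "u' \<noteq> y" for u u' y
  proof -
    obtain n where n: "d u' y = Suc n"
      using ne d_zero_iff V not0_implies_Suc by blast
    then obtain w where w: "u' \<rightarrow>\<^bsub>G\<^esub> w" "d w y = n" using V(2,3) by (rule d_SucE)
    have wV: "w \<in> verts G" using w adj_in_verts by blast
    then have "u = w \<or> u \<rightarrow>\<^bsub>G\<^esub> w" using adj V w eq by metis
    then show ?thesis using w n d_adj_le V(3) by fastforce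
  qed
  fix c c' x y
  assume cc': "c \<rightarrow>\<^bsub>G\<^esub> c'" and xV: "x \<in> verts G" and yV: "y \<in> verts G"
    and geo: "d c x = Suc (d c' x)" and cx: "2 \<le> d c x" and c'y: "2 \<le> d c' y"
  let ?F = "{u. f u = f c'}"
  let ?R = "G \<restriction> (verts G - ?F)"
  interpret D: graph ?R by (rule graph_induce) auto
  interpret H: graph H using H by (simp add: block_graph_def)
  have V: "c \<in> verts G" "c' \<in> verts G" using cc' adj_in_verts by auto
  have twin: "d u w = d c' w" if "u \<in> ?F" "u \<in> verts G" "w \<in> verts G" "w \<notin> ?F" for u w
    using twin_le[of u c' w] twin_le[of c' u w] that V by force
  obtain n where n: "d c' x = Suc n" using cx geo by (cases "d c' x") auto
  \<comment> \<open>\<open>z\<close> follows \<open>c'\<close> on a geodesic from \<open>c\<close>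
    to \<open>x\<close>, possibly with \<open>z = x\<close>. So \<open>c\<close>, \<open>c'\<close>,
    \<open>z\<close> is an induced path, and its image in \<open>H\<close> is one too.\<close>
  then obtain z where z: "c' \<rightarrow>\<^bsub>G\<^esub> z" "d z x = n" using V(2) xV by (rule d_SucE)
  have zV: "z \<in> verts G" using z adj_in_verts by blast
  have cz: "c \<noteq> z" "\<not> c \<rightarrow>\<^bsub>G\<^esub> z"
    using geo n z d_adj_le[of c z x] xV by auto
  have near: "f u = f w \<or> f u \<rightarrow>\<^bsub>H\<^esub> f w" if "u \<rightarrow>\<^bsub>G\<^esub> w" for u w
    using adj[of u w] adj_in_verts[OF that] that by blast
  have fcz: "f c \<noteq> f z" "\<not> f c \<rightarrow>\<^bsub>H\<^esub> f z"
    using cz adj[OF V(1) zV] by blast+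
  have ne: "f c \<noteq> f c'" "f z \<noteq> f c'"
    using near[OF z(1)] near[OF cc'] fcz by metis+
  have fc': "f c \<rightarrow>\<^bsub>H\<^esub> f c'" "f c' \<rightarrow>\<^bsub>H\<^esub> f z"
    using near[OF z(1)] near[OF cc'] ne by metis+
  have "c \<noteq> x" "\<not> c \<rightarrow>\<^bsub>G\<^esub> x" "c' \<noteq> y" "\<not> c' \<rightarrow>\<^bsub>G\<^esub> y"
    using cx c'y V xV yV by (simp_all add: d_ge_two_iff)
  then have "f x \<noteq> f c'" "f y \<noteq> f c'"
    using adj[OF V(1) xV] adj[OF V(2) yV] near[OF cc'] by metis+
  then have cF: "c \<notin> ?F" and xF: "x \<notin> ?F" and yF: "y \<notin> ?F"
    using ne(1) by simp_all
  \<comment> \<open>Through this, separation by the single vertex \<open>f c'\<close> in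
    \<open>H\<close> pulls back to separation by the fibre in \<open>G\<close>.\<close>
  have hom: "f a \<rightarrow>\<^sup>*\<^bsub>H \<restriction> (verts H - {f c'})\<^esub> f b" if "a \<rightarrow>\<^sup>*\<^bsub>?R\<^esub> b" for a b
  proof -
    interpret DH: graph "H \<restriction> (verts H - {f c'})" by (rule H.graph_induce) auto
    show ?thesis
      using that
    proof (induct rule: D.reachable_induct)
      case base
      then show ?case using fV by auto
    next
      case (step s t)
      then have "f s = f t \<or> f s \<rightarrow>\<^bsub>H \<restriction> (verts H - {f c'})\<^esub> f t"
        using fV near[of s t] by (simp add: dominates_induce_subgraph_iff)
      then show ?case using step(3) by (auto intro: DH.reachable_adj_trans)
    qed
  qed
  have "z \<rightarrow>\<^sup>*\<^bsub>?R\<^esub> x"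
    \<comment> \<open>Every vertex of the fibre has distance exactly \<open>d c' x\<close> to
      \<open>x\<close>, and \<open>z\<close> is one step closer.\<close>
    by (rule reachable_below[where k = "d c' x"]) (use zV xV z n twin xF in auto)
  moreover have "\<not> c \<rightarrow>\<^sup>*\<^bsub>?R\<^esub> z"
    using hom block_graph_separates[OF H fc' fcz] by blast
  ultimately have sep: "\<not> c \<rightarrow>\<^sup>*\<^bsub>?R\<^esub> x"
    using D.reachable_trans D.symmetric_reachable' by blast
  show "d c y = Suc (d c' y) \<or> d x y = d x c' + d c' y"
  proof (cases "c \<rightarrow>\<^sup>*\<^bsub>?R\<^esub> y")
    case False
    then obtain u where u: "u \<in> ?F" "u \<in> verts G" "d c y = d c u + d u y"
      using V cF yV yF by (rule_tac geodesic_meets_separator[of c ?F y]) auto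
    \<comment> \<open>Being adjacent to \<open>c'\<close> from outside the fibre, \<open>c\<close>
      is adjacent to all of it, so d(c,u) = 1 as for \<open>c'\<close>.\<close>
    have "c \<rightarrow>\<^bsub>G\<^esub> u" using u(1) ne(1) near[OF cc'] adj[OF V(1) u(2)] by (metis mem_Collect_eq)
    then show ?thesis using u(3) twin[OF u(1,2) yV yF] d_adj by simp
  next
    case True
    then have "\<not> x \<rightarrow>\<^sup>*\<^bsub>?R\<^esub> y"
      using sep D.reachable_trans D.symmetric_reachable' by blast
    then obtain u where u: "u \<in> ?F" "u \<in> verts G" "d x y = d x u + d u y"
      using xV xF yV yF by (rule_tac geodesic_meets_separator[of x ?F y]) auto
    then show ?thesis using twin[OF u(1,2) yV yF] twin[OF u(1,2) xV xF]
        d_sym[OF V(2) xV] d_sym[OF u(2) xV] by simp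
  qed
qed

end

theorem theorem6:
  fixes G :: "('a, 'b) pre_digraph"
  assumes "graph G" and "connected G"
  shows "property_P2 G \<longleftrightarrow> extended_block_graph G"
proof -
  interpret connected_graph G
    using assms by (simp add: connected_graph_def connected_graph_axioms_def)
  show ?thesis
    unfolding extended_block_graph_def
    using assms P2_imp_block_graph_twin_quotient P2_imp_blow_up_via_twin_rep blow_up_imp_P2
    by blast
qed

end
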